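(* Let $m\ge 4$ be an integer and let $a,b>0$ be such that $4a^2+b=1$. Then the mapping $$f:\mathbb{D}\to D:=\{z\in\mathbb{C}^3:(|z_1|+|z_2|)^2+|z_3|<1\},\qquad f(\lambda):=(a\lambda,a\lambda^{m-2},b\lambda^{m-1}),$$ is an $m$-geodesic of $D$ such that $\varphi(\lambda):=f(\lambda)/\lambda$ is not an $(m-1)$-geodesic of $D$.
   Context: $\mathbb{D}$ is the open unit disc in $\mathbb{C}$. A finite Blaschke product of degree $k\in\{0,1,2,\ldots\}$ is a function $\zeta\prod_{j=1}^k m_{\alpha_j}$ with $|\zeta|=1$, $\alpha_j\in\mathbb{D}$, $m_\alpha(\lambda)=\frac{\lambda-\alpha}{1-\overline{\alpha}\lambda}$. For an integer $l\ge 2$, a holomorphic mapping $f:\mathbb{D}\to D$ into a domain $D\subset\mathbb{C}^n$ is an $l$-geodesic if there is a holomorphic $F:D\to\mathbb{D}$ such that $F\circ f$ is a non-constant Blaschke product of degree at most $l-1$. *)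

theory Defs
  imports "HOL-Complex_Analysis.Complex_Analysis"
begin

abbreviation unit_disc :: "complex set" where
  "unit_disc \<equiv> ball 0 1"

definition holomorphic_fun_on :: "(complex ^ 'n \<Rightarrow> complex) \<Rightarrow> (complex ^ 'n) set \<Rightarrow> bool" where
  "holomorphic_fun_on F D \<longleftrightarrow>
     (\<forall>z\<in>D. \<exists>L. (F has_derivative L) (at z) \<and> (\<forall>c v. L (c *s v) = c * L v))"
  \<comment> \<open>for open sets \<open>D\<close>: \<open>has_derivative\<close> supplies a real-linear Frechet derivative,
      which is required to be complex-homogeneous\<close>

definition holomorphic_disc_in :: "(complex \<Rightarrow> complex ^ 'n) \<Rightarrow> (complex ^ 'n) set \<Rightarrow> bool" where
  "holomorphic_disc_in f D \<longleftrightarrow>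
     (\<forall>i. (\<lambda>w. f w $ i) holomorphic_on unit_disc) \<and> f ` unit_disc \<subseteq> D"

definition blaschke_product :: "nat \<Rightarrow> (complex \<Rightarrow> complex) \<Rightarrow> bool" where
  "blaschke_product k B \<longleftrightarrow>
     (\<exists>\<zeta> \<alpha>. norm \<zeta> = 1 \<and> (\<forall>j<k. \<alpha> j \<in> unit_disc) \<and>
        (\<forall>w\<in>unit_disc. B w = \<zeta> * (\<Prod>j<k. Moebius_function 0 (\<alpha> j) w)))"
  \<comment> \<open>\<open>Moebius_function 0 a w = (w - a) / (1 - cnj a * w)\<close>, see \<open>Moebius_function_simple\<close>\<close>

definition geodesic_in :: "nat \<Rightarrow> (complex ^ 'n) set \<Rightarrow> (complex \<Rightarrow> complex ^ 'n) \<Rightarrow> bool" where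
  "geodesic_in l D f \<longleftrightarrow>
     l \<ge> 2 \<and> open D \<and> connected D \<and> holomorphic_disc_in f D \<and>
     (\<exists>F. holomorphic_fun_on F D \<and> F ` D \<subseteq> unit_disc \<and>
        (\<exists>k\<le>l - 1. blaschke_product k (F \<circ> f)) \<and>
        \<not> (F \<circ> f) constant_on unit_disc)"

definition divide_by_id :: "(complex \<Rightarrow> complex ^ 'n) \<Rightarrow> complex \<Rightarrow> complex ^ 'n" where
  "divide_by_id f = (\<lambda>w. \<chi> i. remove_sings (\<lambda>u. f u $ i / u) w)"
  \<comment> \<open>the mapping \<open>f(w)/w\<close>, continued holomorphically to \<open>w = 0\<close>;
      Isabelle's convention \<open>x / 0 = 0\<close> would give the wrong value there\<close>

end

theory Submission
  imports Defs
begin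

text \<open>
  The polynomial \<open>4 z\<^sub>1 z\<^sub>2 + z\<^sub>3\<close> maps the domain into the disc and \<open>f(\<lambda>)\<close> to \<open>\<lambda>\<^sup>m\<^sup>-\<^sup>1\<close>.

  For the negative part put \<open>n = m - 3\<close>, so that \<open>\<phi>(\<lambda>) = (a, a \<lambda>\<^sup>n, b \<lambda>\<^sup>n\<^sup>+\<^sup>1)\<close>, and suppose that
  \<open>F \<circ> \<phi>\<close> is a Blaschke product of degree at most \<open>n + 1\<close>. After composing with a Moebius map
  we may assume \<open>F(\<phi>(0)) = 0\<close>. Then \<open>F(\<phi>(\<lambda>)) = \<lambda>\<^sup>n N(\<lambda>)\<close>, where \<open>N\<close> is a Blaschke product of
  degree at most one, which gives equality \<open>|N'(0)| = 1 - |N(0)|\<^sup>2\<close> in the Schwarz--Pick lemma.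
  On the other hand, Schwarz--Pick on the discs \<open>|z| < 1 - a\<close> and \<open>|w| < 1 - a\<^sup>2\<close> contained in the
  slice \<open>z\<^sub>1 = a\<close> along its two axes yields
  \<open>|N(0)|\<^sup>2 + |N'(0)| \<le> a\<^sup>2 / (1 - a)\<^sup>2 + b / (1 - a\<^sup>2)\<close>, and the right-hand side is less than \<open>1\<close>
  because \<open>b = 1 - 4 a\<^sup>2\<close> and \<open>a < 1/2\<close>.
\<close>

section \<open>Schwarz--Pick estimates at the origin\<close>

lemma Moebius_function_denom_nonzero:
  assumes "norm w \<le> 1" "norm z < 1"
  shows "1 - cnj w * z \<noteq> 0"
proof
  assume "1 - cnj w * z = 0"
  then have "norm w * norm z = 1"
    by (metis complex_mod_cnj norm_mult norm_one right_minus_eq)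
  moreover have "norm w * norm z \<le> norm z"
    using assms(1) by (simp add: mult_left_le_one_le)
  ultimately show False using assms(2) by linarith
qed

text \<open>This is the Schwarz lemma for \<open>f\<close> followed by the Moebius map sending
  \<open>f 0\<close> to \<open>0\<close>, with the denominator multiplied out.\<close>

lemma Schwarz_Pick_at_0:
  assumes holf: "f holomorphic_on ball 0 1"
    and no: "\<And>z. norm z < 1 \<Longrightarrow> norm (f z) < 1"
    and z: "norm z < 1"
  shows "norm (f z - f 0) \<le> norm z * norm (1 - cnj (f 0) * f z)"
proof -
  let ?h = "Moebius_function 0 (f 0) \<circ> f"
  have f0: "norm (f 0) < 1" using no by simp
  have "?h holomorphic_on ball 0 1"
    using holf Moebius_function_holomorphic[OF f0]
    by (rule holomorphic_on_compose_gen) (use no in auto)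
  moreover have "?h 0 = 0" by (simp add: Moebius_function_eq_zero)
  moreover have "norm (?h z) < 1" if "norm z < 1" for z
    using Moebius_function_norm_lt_1[OF f0 no[OF that]] by simp
  ultimately have "norm (?h z) \<le> norm z"
    using Schwarz_Lemma(1) z by blast
  moreover have "1 - cnj (f 0) * f z \<noteq> 0"
    using Moebius_function_denom_nonzero f0 no[OF z] by simp
  ultimately show ?thesis
    by (simp add: Moebius_function_simple norm_divide divide_le_eq)
qed

text \<open>Divide the previous estimate by \<open>norm z\<close> and let \<open>z\<close> tend to
  \<open>0\<close>. The bound on \<open>f\<close> is non-strict because the estimate is later
  applied to a Schwarz quotient, which may be a unimodular constant; by the maximum principle
  \<open>f\<close> is constant if modulus 1 is attained, and then both sides vanish.\<close>

lemma Schwarz_Pick_deriv_0: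
  assumes holf: "f holomorphic_on ball 0 1"
    and no: "\<And>z. norm z < 1 \<Longrightarrow> norm (f z) \<le> 1"
  shows "norm (deriv f 0) \<le> 1 - (norm (f 0))\<^sup>2"
proof (cases "\<exists>z\<in>ball 0 1. norm (f z) = 1")
  case True
  then obtain z where z: "z \<in> ball 0 1" "norm (f z) = 1" by blast
  have "f constant_on ball 0 1"
    by (rule maximum_modulus_principle[OF holf, of "ball 0 1" z]) (use z no in auto)
  then obtain c where c: "\<And>w. w \<in> ball 0 1 \<Longrightarrow> f w = c"
    by (auto simp: constant_on_def)
  have "deriv f 0 = deriv (\<lambda>_. c) 0"
    by (rule deriv_cong_ev) (auto intro!: eventually_nhds_in_open[THEN eventually_mono, of "ball 0 1"] c)
  moreover have "norm (f 0) = 1" using c z by simp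
  ultimately show ?thesis by simp
next
  case False
  with no have lt: "norm (f z) < 1" if "norm z < 1" for z
    using that by (metis mem_ball_0 order_le_less)
  have der: "(f has_field_derivative deriv f 0) (at 0)"
    using holf by (auto intro!: holomorphic_derivI[where S = "ball 0 1"])
  then have 1: "((\<lambda>z. norm ((f z - f 0) / z)) \<longlongrightarrow> norm (deriv f 0)) (at 0)"
    by (intro tendsto_norm) (simp add: has_field_derivative_iff)
  have 2: "((\<lambda>z. norm (1 - cnj (f 0) * f z)) \<longlongrightarrow> norm (1 - cnj (f 0) * f 0)) (at 0)"
    using DERIV_isCont[OF der] by (auto intro!: tendsto_intros simp: isCont_def)
  have "norm (deriv f 0) \<le> norm (1 - cnj (f 0) * f 0)"
  proof (rule tendsto_le[OF _ 2 1])
    have "\<forall>\<^sub>F z in at 0. z \<in> ball (0::complex) 1 - {0}"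
      by (intro eventually_at_in_open) auto
    then show "\<forall>\<^sub>F z in at 0. norm ((f z - f 0) / z) \<le> norm (1 - cnj (f 0) * f z)"
      by eventually_elim
        (use Schwarz_Pick_at_0[OF holf lt] in \<open>auto simp: norm_divide divide_le_eq mult.commute\<close>)
  qed simp
  also have "1 - cnj (f 0) * f 0 = of_real (1 - (norm (f 0))\<^sup>2)"
    by (simp only: mult.commute[of "cnj (f 0)"] complex_norm_square[symmetric]) simp
  also have "norm \<dots> = 1 - (norm (f 0))\<^sup>2"
    unfolding norm_of_real using lt[of 0] by (simp add: power_le_one)
  finally show ?thesis .
qed

section \<open>Blaschke products with a zero of high order\<close>

text \<open>The bound forces a root at \<open>0\<close>; splitting off the factor \<open>w\<close>
  lowers the exponent by one, hence the induction.\<close>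

lemma poly_eq_monom_mult_if_norm_le:
  fixes p :: "complex poly"
  assumes "\<And>w. w \<in> ball 0 1 - {0} \<Longrightarrow> norm (poly p w) \<le> C * norm w ^ n"
  obtains q where "p = monom 1 n * q"
  using assms
proof (induction n arbitrary: p thesis)
  case 0
  then show ?case by (simp add: monom_0)
next
  case (Suc n)
  have "norm (poly p 0) \<le> C * norm (0::complex) ^ Suc n"
  proof (rule tendsto_le)
    show "((\<lambda>w. norm (poly p w)) \<longlongrightarrow> norm (poly p 0)) (at 0)"
      by (intro tendsto_norm) (metis isCont_def poly_isCont)
    show "((\<lambda>w::complex. C * norm w ^ Suc n) \<longlongrightarrow> C * norm (0::complex) ^ Suc n) (at 0)"
      by (intro tendsto_intros)
    have "\<forall>\<^sub>F z in at 0. z \<in> ball (0::complex) 1 - {0}"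
      by (intro eventually_at_in_open) auto
    then show "\<forall>\<^sub>F w in at 0. norm (poly p w) \<le> C * norm w ^ Suc n"
      by eventually_elim (use Suc.prems(2) in blast)
  qed simp
  then have "poly p 0 = 0" by simp
  then obtain r where r: "p = [:0, 1:] * r"
    by (metis dvdE minus_zero poly_eq_0_iff_dvd)
  have "norm (poly r w) \<le> C * norm w ^ n" if "w \<in> ball 0 1 - {0}" for w
    using Suc.prems(2)[OF that] that by (simp add: r norm_mult mult.left_commute)
  then obtain q where "r = monom 1 n * q"
    using Suc.IH by blast
  then have "p = monom 1 (Suc n) * q"
    by (simp add: r monom_Suc)
  then show ?case by (rule Suc.prems(1))
qed

text \<open>Extra factors with zero \<open>1\<close> on the unit circle are the constant \<open>-1\<close>, so the degree can be
  raised to any \<open>K\<close>.\<close>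

lemma blaschke_product_padded:
  assumes "blaschke_product k B" "k \<le> K"
  obtains \<zeta> \<alpha> where "norm \<zeta> = 1" "\<And>j. norm (\<alpha> j) \<le> 1"
    "\<And>w. w \<in> unit_disc \<Longrightarrow> B w = \<zeta> * (\<Prod>j<K. Moebius_function 0 (\<alpha> j) w)"
proof -
  obtain \<zeta> \<alpha> where \<zeta>: "norm \<zeta> = 1" and \<alpha>: "\<And>j. j < k \<Longrightarrow> \<alpha> j \<in> unit_disc"
    and B: "\<And>w. w \<in> unit_disc \<Longrightarrow> B w = \<zeta> * (\<Prod>j<k. Moebius_function 0 (\<alpha> j) w)"
    using assms(1) unfolding blaschke_product_def by blast
  define \<alpha>' where "\<alpha>' = (\<lambda>j. if j < k then \<alpha> j else 1)"
  have split: "{..<K} = {..<k} \<union> {k..<K}" using assms(2) by auto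
  show ?thesis
  proof
    show "norm (\<zeta> * (-1) ^ (K - k)) = 1" by (simp add: \<zeta> norm_mult norm_power)
    show "norm (\<alpha>' j) \<le> 1" for j using \<alpha>[of j] by (auto simp: \<alpha>'_def)
    show "B w = \<zeta> * (-1) ^ (K - k) * (\<Prod>j<K. Moebius_function 0 (\<alpha>' j) w)"
      if w: "w \<in> unit_disc" for w
    proof -
      have "1 - w \<noteq> 0" using w by auto
      then have "Moebius_function 0 1 w = -1"
        by (simp add: Moebius_function_simple divide_eq_eq)
      then have "(\<Prod>j\<in>{k..<K}. Moebius_function 0 (\<alpha>' j) w) = (-1) ^ (K - k)"
        by (simp add: \<alpha>'_def)
      moreover have "(\<Prod>j<k. Moebius_function 0 (\<alpha>' j) w) = (\<Prod>j<k. Moebius_function 0 (\<alpha> j) w)"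
        by (simp add: \<alpha>'_def)
      ultimately have "(\<Prod>j<K. Moebius_function 0 (\<alpha>' j) w)
          = (\<Prod>j<k. Moebius_function 0 (\<alpha> j) w) * (-1) ^ (K - k)"
        unfolding split by (subst prod.union_disjoint) auto
      then show ?thesis by (simp add: B[OF w] flip: power_mult_distrib)
    qed
  qed
qed

text \<open>A Moebius map keeps a Blaschke product of degree at most \<open>n + 1\<close> in that
  class. The zero of order \<open>n\<close> at \<open>0\<close> uses up \<open>n\<close> factors, so
  \<open>N\<close> is a disc automorphism or a unimodular constant, and both give equality in
  Schwarz--Pick.\<close>

lemma blaschke_product_Moebius_zero_order:
  fixes n :: nat
  assumes B: "blaschke_product k B" and k: "k \<le> Suc n" and n: "n > 0"
    and lt1: "\<And>w. w \<in> unit_disc \<Longrightarrow> norm (B w) < 1"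
    and bigO: "\<And>w. w \<in> unit_disc \<Longrightarrow> norm (Moebius_function 0 (B 0) (B w)) \<le> C * norm w ^ n"
  obtains N where "N holomorphic_on unit_disc"
    "\<And>w. w \<in> unit_disc \<Longrightarrow> Moebius_function 0 (B 0) (B w) = w ^ n * N w"
    "norm (deriv N 0) = 1 - (norm (N 0))\<^sup>2"
proof -
  obtain \<zeta> \<alpha> where \<zeta>: "norm \<zeta> = 1" and \<alpha>: "\<And>j. norm (\<alpha> j) \<le> 1"
    and Beq: "\<And>w. w \<in> unit_disc \<Longrightarrow> B w = \<zeta> * (\<Prod>j<Suc n. Moebius_function 0 (\<alpha> j) w)"
    using blaschke_product_padded[OF B k] by metis
  define P where "P = smult \<zeta> (\<Prod>j<Suc n. [:- \<alpha> j, 1:])"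
  define Q where "Q = (\<Prod>j<Suc n. [:1, - cnj (\<alpha> j):])"
  define \<beta> where "\<beta> = B 0"
  \<comment> \<open>Since \<open>B = P / Q\<close>, the Moebius image of \<open>B\<close> is
    \<open>U / V\<close> once \<open>Q\<close> is cleared.\<close>
  define U where "U = P - smult \<beta> Q"
  define V where "V = Q - smult (cnj \<beta>) P"
  have \<zeta>2: "\<zeta> * cnj \<zeta> = 1" using \<zeta> by (simp add: complex_norm_square[symmetric])
  have \<beta>1: "norm \<beta> < 1" using lt1[of 0] by (simp add: \<beta>_def)
  have P: "poly P w = \<zeta> * (\<Prod>j<Suc n. w - \<alpha> j)" for w
    unfolding P_def poly_smult poly_prod by simp
  have Q: "poly Q w = (\<Prod>j<Suc n. 1 - cnj (\<alpha> j) * w)" for w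
    unfolding Q_def poly_prod by (simp add: mult.commute)
  have Qn0: "poly Q w \<noteq> 0" if "w \<in> unit_disc" for w
    unfolding Q using that Moebius_function_denom_nonzero[OF \<alpha>] by (subst prod_zero_iff) auto
  have BPQ: "B w = poly P w / poly Q w" if "w \<in> unit_disc" for w
    using Beq[OF that] unfolding P Q by (simp add: Moebius_function_simple prod_dividef)
  \<comment> \<open>\<open>P\<close> and \<open>Q\<close>, hence also \<open>U\<close> and \<open>V\<close>, are exchanged by reflection in the unit circle:
      since \<open>U\<close> is \<open>w\<^sup>n\<close> times a linear factor, \<open>V\<close> is linear.\<close>
  have reflect: "poly Q w = \<zeta> * w ^ Suc n * cnj (poly P (1 / cnj w))"
    "poly P w = \<zeta> * w ^ Suc n * cnj (poly Q (1 / cnj w))" if "w \<noteq> 0" for w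
  proof -
    have pw: "w ^ Suc n = (\<Prod>j<Suc n. w)" by simp
    have "w ^ Suc n * cnj (\<Prod>j<Suc n. 1 / cnj w - \<alpha> j) = poly Q w"
      unfolding Q pw cnj_prod prod.distrib[symmetric]
      by (rule prod.cong) (use that in \<open>auto simp: field_simps\<close>)
    then show "poly Q w = \<zeta> * w ^ Suc n * cnj (poly P (1 / cnj w))"
      unfolding P using \<zeta>2 by (simp add: mult.assoc mult.left_commute del: prod.lessThan_Suc power_Suc)
    have "w ^ Suc n * cnj (poly Q (1 / cnj w)) = (\<Prod>j<Suc n. w - \<alpha> j)"
      unfolding Q pw cnj_prod prod.distrib[symmetric]
      by (rule prod.cong) (use that in \<open>auto simp: field_simps\<close>)
    then show "poly P w = \<zeta> * w ^ Suc n * cnj (poly Q (1 / cnj w))"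
      unfolding P by (simp add: mult.assoc del: prod.lessThan_Suc power_Suc)
  qed
  have Vn0: "poly V w \<noteq> 0" if "w \<in> unit_disc" for w
  proof
    assume "poly V w = 0"
    then have "1 - cnj \<beta> * B w = 0"
      using Qn0[OF that] by (simp add: V_def BPQ[OF that] field_simps)
    then show False
      using Moebius_function_denom_nonzero[of \<beta> "B w"] \<beta>1 lt1[OF that] by simp
  qed
  have M: "Moebius_function 0 \<beta> (B w) = poly U w / poly V w" if "w \<in> unit_disc" for w
  proof -
    have "1 - cnj \<beta> * B w \<noteq> 0"
      using Moebius_function_denom_nonzero[of \<beta> "B w"] \<beta>1 lt1[OF that] by simp
    then show ?thesis
      using Qn0[OF that] Vn0[OF that]
      by (simp add: Moebius_function_simple U_def V_def BPQ[OF that] divide_simps)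
  qed
  \<comment> \<open>A bound for \<open>V\<close> turns the growth hypothesis on \<open>U / V\<close>
    into one on the polynomial \<open>U\<close>.\<close>
  obtain K where K: "\<And>w. norm w \<le> 1 \<Longrightarrow> norm (poly V w) \<le> K"
  proof -
    have "bounded (poly V ` cball 0 1)"
      by (intro compact_imp_bounded compact_continuous_image continuous_intros) auto
    then obtain K where "\<forall>w\<in>cball 0 1. norm (poly V w) \<le> K"
      by (auto simp: bounded_iff)
    then show ?thesis using that[of K] by simp
  qed
  have "norm (poly U w) \<le> (C * K) * norm w ^ n" if "w \<in> ball 0 1 - {0}" for w
  proof -
    have "norm (poly U w) = norm (Moebius_function 0 \<beta> (B w)) * norm (poly V w)"
      using that Vn0[of w] by (simp add: M norm_divide)
    also have "\<dots> \<le> (C * norm w ^ n) * K"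
      using that bigO[of w] K[of w] by (intro mult_mono) (auto simp: \<beta>_def intro: order_trans[OF norm_ge_zero])
    finally show ?thesis by (simp add: mult_ac)
  qed
  then obtain W where W: "U = monom 1 n * W"
    using poly_eq_monom_mult_if_norm_le by blast
  have deg: "degree (\<Prod>j<Suc n. p j) \<le> Suc n" if "\<And>j. degree (p j) \<le> 1" for p :: "nat \<Rightarrow> complex poly"
    using order_trans[OF degree_prod_sum_le sum_bounded_above[of "{..<Suc n}" "degree \<circ> p" 1]] that by simp
  have "degree (\<Prod>j<Suc n. [:- \<alpha> j, 1:]) \<le> Suc n" "degree Q \<le> Suc n"
    unfolding Q_def by (rule deg; simp)+
  then have "degree U \<le> Suc n"
    unfolding U_def P_def by (intro degree_diff_le) (auto intro: order_trans[OF degree_smult_le])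
  then have "degree W \<le> 1"
    unfolding W by (cases "W = 0") (auto simp: degree_mult_eq degree_monom_eq)
  then have "W = [:coeff W 0, coeff W 1:]"
    by (intro poly_eqI) (auto simp: coeff_pCons coeff_eq_0 split: nat.split)
  then obtain u v where uv: "W = [:u, v:]" by blast
  \<comment> \<open>Reflecting \<open>U = w^n (u + v w)\<close> gives
    \<open>\<zeta> (cnj v + cnj u w)\<close>. The extra factor \<open>w\<close> makes the identity
    hold also at \<open>w = 0\<close>, where the reflected point is undefined.\<close>
  have "[:0, 1:] * (V - smult \<zeta> [:cnj v, cnj u:]) = 0"
  proof -
    have "poly ([:0, 1:] * (V - smult \<zeta> [:cnj v, cnj u:])) w = 0" for w
    proof (cases "w = 0")
      case False
      have "poly V w = \<zeta> * w ^ Suc n * cnj (poly U (1 / cnj w))"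
        unfolding V_def U_def using reflect[OF False] by (simp add: algebra_simps)
      also have "\<dots> = \<zeta> * (cnj v + cnj u * w)"
        using False by (simp add: W uv poly_monom field_simps)
      finally show ?thesis by (simp add: algebra_simps)
    qed simp
    then show ?thesis using poly_all_0_iff_0 by blast
  qed
  then have V: "V = smult \<zeta> [:cnj v, cnj u:]" by simp
  have v0: "v \<noteq> 0" using Vn0[of 0] by (auto simp: V)
  \<comment> \<open>Otherwise the root \<open>- cnj v / cnj u\<close> of \<open>V\<close> would lie
    in the disc.\<close>
  have uv_le: "norm u \<le> norm v"
  proof (rule ccontr)
    assume "\<not> norm u \<le> norm v"
    then have "norm v < norm u" and u0: "u \<noteq> 0" by auto
    then have "- cnj v / cnj u \<in> unit_disc" by (simp add: norm_divide divide_less_eq_1)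
    with u0 show False using Vn0[of "- cnj v / cnj u"] by (simp add: V)
  qed
  define N where "N = (\<lambda>w. (u + v * w) / (\<zeta> * (cnj v + cnj u * w)))"
  have den: "\<zeta> * (cnj v + cnj u * w) \<noteq> 0" if "w \<in> unit_disc" for w
    using Vn0[OF that] by (simp add: V algebra_simps)
  have "(N has_field_derivative (v * (\<zeta> * cnj v) - u * (\<zeta> * cnj u)) / (\<zeta> * cnj v)\<^sup>2) (at 0)"
    unfolding N_def using den[of 0]
    by (auto intro!: derivative_eq_intros simp: power2_eq_square)
  then have "deriv N 0 = \<zeta> * (v * cnj v - u * cnj u) / (\<zeta> * cnj v)\<^sup>2"
    by (simp add: DERIV_imp_deriv algebra_simps)
  also have "v * cnj v - u * cnj u = of_real ((norm v)\<^sup>2 - (norm u)\<^sup>2)"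
    by (simp only: of_real_diff complex_norm_square)
  also have "norm (\<zeta> * of_real ((norm v)\<^sup>2 - (norm u)\<^sup>2) / (\<zeta> * cnj v)\<^sup>2)
      = ((norm v)\<^sup>2 - (norm u)\<^sup>2) / (norm v)\<^sup>2"
    using uv_le \<zeta> by (simp add: norm_mult norm_divide norm_power power_mono del: of_real_diff)
  also have "\<dots> = 1 - (norm (N 0))\<^sup>2"
    using v0 \<zeta> by (simp add: N_def norm_divide norm_mult power_divide diff_divide_distrib)
  finally have "norm (deriv N 0) = 1 - (norm (N 0))\<^sup>2" .
  moreover have "N holomorphic_on unit_disc"
    unfolding N_def using den by (intro holomorphic_intros) auto
  moreover have "Moebius_function 0 (B 0) (B w) = w ^ n * N w" if "w \<in> unit_disc" for w
    unfolding \<beta>_def[symmetric] M[OF that] by (simp add: W V N_def uv poly_monom algebra_simps)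
  ultimately show ?thesis using that by blast
qed

section \<open>Comparison of first-order Taylor coefficients\<close>

text \<open>With \<open>\<kappa> w = c h(c w^n)\<close>, letting \<open>w\<close> tend to
  \<open>0\<close> in the hypothesis gives \<open>N 0 = \<kappa> 0\<close>, and after division by
  \<open>w\<close> it bounds \<open>N'(0) - \<kappa>'(0)\<close> by the limit of
  \<open>\<rho>\<close>. Schwarz--Pick for \<open>h\<close> bounds \<open>\<kappa>'(0)\<close> by
  \<open>c^2 (1 - |h(0)|^2)\<close>, and the terms in \<open>|h(0)|^2\<close> cancel.\<close>

lemma Schwarz_Pick_difference_coefficients:
  fixes c :: real and n :: nat
  assumes holh: "h holomorphic_on unit_disc" and h1: "\<And>z. norm z < 1 \<Longrightarrow> norm (h z) \<le> 1"
    and holN: "N holomorphic_on unit_disc"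
    and c: "0 \<le> c" "c < 1" and n: "n > 0"
    and \<rho>: "(\<rho> \<longlongrightarrow> \<rho>\<^sub>0) (at 0)"
    and le: "\<And>w. w \<in> unit_disc - {0} \<Longrightarrow>
      norm (N w - of_real c * h (of_real c * w ^ n)) \<le> norm w * \<rho> w"
  shows "(norm (N 0))\<^sup>2 + norm (deriv N 0) \<le> c\<^sup>2 + \<rho>\<^sub>0"
proof -
  define \<kappa> where "\<kappa> = (\<lambda>w. of_real c * h (of_real c * w ^ n))"
  \<comment> \<open>The power \<open>0 ^ (n - 1)\<close> is \<open>1\<close> for
    \<open>n = 1\<close> and \<open>0\<close> for larger \<open>n\<close>; this is the case split
    below.\<close>
  define \<kappa>' where "\<kappa>' = of_real c * (deriv h 0 * (of_real c * (of_nat n * 0 ^ (n - 1))))"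
  have "(h has_field_derivative deriv h 0) (at 0)"
    using holh by (auto intro!: holomorphic_derivI[where S = "ball 0 1"])
  then have h': "(h has_field_derivative deriv h 0) (at (of_real c * 0 ^ n))"
    using n by (simp add: zero_power)
  have i': "((\<lambda>w. of_real c * w ^ n) has_field_derivative of_real c * (of_nat n * 0 ^ (n - 1))) (at (0::complex))"
    by (auto intro!: derivative_eq_intros)
  then have d\<kappa>: "(\<kappa> has_field_derivative \<kappa>') (at 0)"
    unfolding \<kappa>_def \<kappa>'_def by (intro DERIV_cmult DERIV_chain2[where f = h and g = "\<lambda>w. of_real c * w ^ n"] h' i')
  have dN: "(N has_field_derivative deriv N 0) (at 0)"
    using holN by (auto intro!: holomorphic_derivI[where S = "ball 0 1"])
  have ev: "\<forall>\<^sub>F w in at 0. w \<in> unit_disc - {0::complex}"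
    by (intro eventually_at_in_open) auto
  have d: "((\<lambda>w. N w - \<kappa> w) has_field_derivative deriv N 0 - \<kappa>') (at 0)"
    by (intro DERIV_diff dN d\<kappa>)
  have "norm (N 0 - \<kappa> 0) \<le> 0"
  proof (rule tendsto_le)
    show "((\<lambda>w. norm (N w - \<kappa> w)) \<longlongrightarrow> norm (N 0 - \<kappa> 0)) (at 0)"
      using DERIV_isCont[OF d] by (intro tendsto_norm) (simp add: isCont_def)
    have "((\<lambda>w. norm w * \<rho> w) \<longlongrightarrow> norm (0::complex) * \<rho>\<^sub>0) (at 0)"
      by (intro tendsto_intros \<rho>)
    then show "((\<lambda>w::complex. norm w * \<rho> w) \<longlongrightarrow> 0) (at 0)" by simp
    show "\<forall>\<^sub>F w in at 0. norm (N w - \<kappa> w) \<le> norm w * \<rho> w"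
      using ev by eventually_elim (use le in \<open>simp add: \<kappa>_def\<close>)
  qed simp
  then have N0: "N 0 = \<kappa> 0" by simp
  have "norm (deriv N 0 - \<kappa>') \<le> \<rho>\<^sub>0"
  proof (rule tendsto_le[OF _ \<rho>])
    show "((\<lambda>w. norm ((N w - \<kappa> w) / w)) \<longlongrightarrow> norm (deriv N 0 - \<kappa>')) (at 0)"
      using d by (intro tendsto_norm) (simp add: has_field_derivative_iff N0)
    show "\<forall>\<^sub>F w in at 0. norm ((N w - \<kappa> w) / w) \<le> \<rho> w"
      using ev by eventually_elim
        (use le in \<open>auto simp: \<kappa>_def norm_divide divide_le_eq mult.commute\<close>)
  qed simp
  moreover have "norm \<kappa>' \<le> c\<^sup>2 * (1 - (norm (h 0))\<^sup>2)"
  proof (cases "n = 1")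
    case True
    then have "norm \<kappa>' = c\<^sup>2 * norm (deriv h 0)"
      using c by (simp add: \<kappa>'_def norm_mult power2_eq_square)
    then show ?thesis
      using Schwarz_Pick_deriv_0[OF holh h1] by (simp add: mult_left_mono)
  next
    case False
    then have "\<kappa>' = 0" using n by (simp add: \<kappa>'_def)
    then show ?thesis using h1[of 0] by (simp add: power_le_one)
  qed
  moreover have "(norm (N 0))\<^sup>2 = c\<^sup>2 * (norm (h 0))\<^sup>2"
    using n c by (simp add: N0 \<kappa>_def norm_mult power_mult_distrib zero_power)
  moreover have "norm (deriv N 0) \<le> norm (deriv N 0 - \<kappa>') + norm \<kappa>'"
    using norm_triangle_sub by (metis add.commute)
  ultimately show ?thesis by (simp add: algebra_simps)
qed

section \<open>Complex lines and points of the domain\<close>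

text \<open>This reduces several variables to one. By homogeneity the Frechet derivative along the
  line is multiplication by \<open>L e\<close>.\<close>

lemma holomorphic_fun_on_line:
  fixes p e :: "complex ^ 'n"
  assumes F: "holomorphic_fun_on F D" and D: "\<And>t. t \<in> T \<Longrightarrow> p + t *s e \<in> D"
  shows "(\<lambda>t. F (p + t *s e)) holomorphic_on T"
  unfolding holomorphic_on_def
proof
  fix t assume "t \<in> T"
  then obtain L where L: "(F has_derivative L) (at (p + t *s e))"
    and hom: "\<And>c v. L (c *s v) = c * L v"
    using F D unfolding holomorphic_fun_on_def by blast
  have "linear (\<lambda>t. t *s e)"
    by (rule linearI) (simp_all add: vec_eq_iff algebra_simps)
  then have "((\<lambda>t. t *s e) has_derivative (\<lambda>t. t *s e)) (at t)"
    by (intro bounded_linear_imp_has_derivative) (simp add: linear_conv_bounded_linear)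
  then have "((\<lambda>t. p + t *s e) has_derivative (\<lambda>t. t *s e)) (at t)"
    by (auto intro: derivative_eq_intros)
  from has_derivative_compose[OF this L]
  have "((\<lambda>t. F (p + t *s e)) has_field_derivative L e) (at t)"
    by (simp add: has_field_derivative_def hom mult_commute_abs)
  then show "(\<lambda>t. F (p + t *s e)) field_differentiable at t within T"
    using field_differentiable_at_within field_differentiable_def by blast
qed

abbreviation (input) Dom :: "(complex ^ 3) set" where
  "Dom \<equiv> {z. (norm (z $ 1) + norm (z $ 2))\<^sup>2 + norm (z $ 3) < 1}"

text \<open>The bounds on \<open>x\<close> and \<open>y\<close> are non-strict so that the constant
  first coordinate \<open>a\<close> of \<open>\<phi>\<close> is covered by
  \<open>x = 1\<close>.\<close>

lemma scaled_polydisc_in_Dom: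
  fixes a b :: real
  assumes "a > 0" "b > 0" "4 * a\<^sup>2 + b = 1" and "norm x \<le> 1" "norm y \<le> 1" "norm z < 1"
  shows "vector [of_real a * x, of_real a * y, of_real b * z] \<in> Dom"
proof -
  have "a * norm x \<le> a" "a * norm y \<le> a" using assms by (simp_all add: mult_left_le)
  then have "(a * norm x + a * norm y)\<^sup>2 \<le> (2 * a)\<^sup>2"
    using assms(1) by (intro power_mono) (linarith, simp)
  moreover have "b * norm z < b" using assms by simp
  ultimately have "(a * norm x + a * norm y)\<^sup>2 + b * norm z < 1"
    using assms(3) by (simp only: power2_eq_square)
  then show ?thesis using assms(1,2) by (simp add: norm_mult)
qed

lemma norm_power_Suc_less_one:
  fixes w :: "'a :: real_normed_div_algebra"
  shows "norm w < 1 \<Longrightarrow> norm (w ^ Suc n) < 1"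
  using mult_left_le[of "norm w ^ n" "norm w"] power_le_one[of "norm w" n]
  by (simp add: norm_mult norm_power)

section \<open>The reduced curve is not a geodesic\<close>

lemma no_left_inverse_of_reduced_curve:
  fixes a b :: real and n :: nat
  assumes a: "a > 0" and b: "b > 0" and ab: "4 * a\<^sup>2 + b = 1" and n: "n > 0"
    and F: "holomorphic_fun_on F Dom" and F1: "F ` Dom \<subseteq> unit_disc"
    and k: "k \<le> Suc n"
  shows "\<not> blaschke_product k (\<lambda>w. F (vector [of_real a, of_real a * w ^ n, of_real b * w ^ Suc n]))"
    (is "\<not> blaschke_product k ?B")
proof
  assume B: "blaschke_product k ?B"
  define \<beta> where "\<beta> = ?B 0"
  \<comment> \<open>\<open>G\<close> is \<open>F\<close> on the slice \<open>z_1 = a\<close>,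
    normalised so that \<open>G 0 0 = 0\<close>. In this slice \<open>R\<close> is the radius of the
    disc on the second axis, and \<open>r w\<close> that of the disc in the third coordinate above
    \<open>a w^n\<close>.\<close>
  define G where "G = (\<lambda>z w. Moebius_function 0 \<beta> (F (vector [of_real a, z, w])))"
  define R where "R = 1 - a"
  define r where "r = (\<lambda>w::complex. 1 - (a + a * norm w ^ n)\<^sup>2)"
  have a2: "a < 1 / 2"
  proof (rule ccontr)
    assume "\<not> a < 1 / 2"
    then have "(1 / 2)\<^sup>2 \<le> a\<^sup>2" by (intro power_mono) auto
    then show False using ab b by (simp add: power2_eq_square)
  qed
  have R: "R > 0" "a < R" using a2 a by (auto simp: R_def)
  have mem: "vector [of_real a, z, w] \<in> Dom \<longleftrightarrow> (a + norm z)\<^sup>2 + norm w < 1" for z w :: complex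
    using a by simp
  have r_ge: "b \<le> r w" if "norm w < 1" for w
  proof -
    have "norm w ^ n \<le> 1" using that by (simp add: power_le_one)
    then have "(a + a * norm w ^ n)\<^sup>2 \<le> (2 * a)\<^sup>2" using a by (intro power_mono) (auto simp: mult_left_le)
    then show ?thesis using ab by (simp add: r_def power_mult_distrib)
  qed
  have slice: "vector [of_real a, of_real a * w ^ n, of_real (r w) * t] \<in> Dom"
    if "norm w < 1" "norm t < 1" for w t
  proof -
    have "r w * norm t < r w" using r_ge[OF that(1)] b that(2) by simp
    moreover have "norm (of_real (r w) * t) = r w * norm t" using r_ge[OF that(1)] b by (simp add: norm_mult)
    moreover have "norm (of_real a * w ^ n) = a * norm w ^ n" using a by (simp add: norm_mult norm_power)
    ultimately show ?thesis unfolding mem by (simp only: r_def)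
  qed
  have curve: "vector [of_real a, of_real a * w ^ n, of_real b * w ^ Suc n] \<in> Dom" if "norm w < 1" for w
    using scaled_polydisc_in_Dom[OF a b ab, of 1 "w ^ n" "w ^ Suc n"] norm_power_Suc_less_one[OF that] that
    by (simp add: norm_power power_le_one)
  have axis: "vector [of_real a, of_real R * z, 0] \<in> Dom" if "norm z < 1" for z
  proof -
    have "R * norm z < R" using R that by simp
    then have "a + R * norm z < 1" by (simp add: R_def)
    then have "(a + R * norm z)\<^sup>2 < 1" using a R by (simp add: power_less_one_iff abs_square_less_1)
    then show ?thesis unfolding mem using R by (simp add: norm_mult)
  qed
  have F_lt: "norm (F z) < 1" if "z \<in> Dom" for z using F1 that by (auto simp del: mem_Collect_eq)
  have \<beta>: "norm \<beta> < 1" unfolding \<beta>_def by (rule F_lt[OF curve]) simp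
  have G_lt: "norm (G z w) < 1" if "vector [of_real a, z, w] \<in> Dom" for z w
    unfolding G_def by (rule Moebius_function_norm_lt_1[OF \<beta> F_lt[OF that]])
  have G0: "G 0 0 = 0" using n by (simp add: G_def \<beta>_def Moebius_function_eq_zero zero_power)
  have holG: "(\<lambda>t. Moebius_function 0 \<beta> (F (p + t *s e))) holomorphic_on T"
    if "\<And>t. t \<in> T \<Longrightarrow> p + t *s e \<in> Dom" for p e T
    using holomorphic_on_compose_gen[OF holomorphic_fun_on_line[OF F that] Moebius_function_holomorphic[OF \<beta>]] F_lt that
    by (auto simp: o_def image_subset_iff simp del: mem_Collect_eq)
  \<comment> \<open>These identities present the two discs as parametrised affine lines, the form
    required by \<open>holG\<close>.\<close>
  have line3: "vector [x, y, of_real s * t] = vector [x, y, 0] + t *s (vector [0, 0, of_real s] :: complex ^ 3)" for x y t :: complex and s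
    by (simp add: vec_eq_iff forall_3 mult.commute)
  have line2: "vector [x, of_real s * t, 0] = vector [x, 0, 0] + t *s (vector [0, of_real s, 0] :: complex ^ 3)" for x t :: complex and s
    by (simp add: vec_eq_iff forall_3 mult.commute)
  have holg: "(\<lambda>z. G (of_real R * z) 0) holomorphic_on unit_disc"
    unfolding G_def line2 using axis by (intro holG) (simp flip: line2)
  from holg obtain h where holh: "h holomorphic_on unit_disc"
    and h: "\<And>z. norm z < 1 \<Longrightarrow> G (of_real R * z) 0 = z * h z"
    and h0: "deriv (\<lambda>z. G (of_real R * z) 0) 0 = h 0"
    by (rule Schwarz3) (use G0 in auto)
  have h1: "norm (h z) \<le> 1" if "norm z < 1" for z
  proof -
    have "norm (G (of_real R * z) 0) \<le> norm z" "norm (deriv (\<lambda>z. G (of_real R * z) 0) 0) \<le> 1"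
      using Schwarz_Lemma(1,2)[OF holg _ _ that] G0 G_lt axis by auto
    then show ?thesis
      using h[OF that] h0 by (cases "z = 0") (auto simp: norm_mult)
  qed
  \<comment> \<open>Thus \<open>R * (c w^n) = a w^n\<close>, so the axis estimate is evaluated at
    \<open>c w^n\<close>; \<open>c < 1\<close> because \<open>a < 1/2\<close>.\<close>
  define c where "c = a / R"
  have c: "0 \<le> c" "c < 1" using a R by (auto simp: c_def)
  have cw: "norm (of_real c * w ^ n) < 1" if "norm w < 1" for w :: complex
  proof -
    have "norm (of_real c * w ^ n) \<le> c * 1"
      unfolding norm_mult norm_power using c that by (intro mult_mono) (auto simp: power_le_one)
    then show ?thesis using c by simp
  qed
  have axis_h: "G (of_real a * w ^ n) 0 = w ^ n * (of_real c * h (of_real c * w ^ n))" if "norm w < 1" for w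
    using h[OF cw[OF that]] R by (simp add: c_def mult_ac)
  \<comment> \<open>Schwarz--Pick on the disc of radius \<open>r w\<close>, between its centre and
    the parameter \<open>t = (b / r w) w^(n+1)\<close>, which is the point of the curve.\<close>
  have diff: "norm (G (of_real a * w ^ n) (of_real b * w ^ Suc n) - G (of_real a * w ^ n) 0)
      \<le> (b / r w * norm w ^ Suc n) *
        norm (1 - cnj (G (of_real a * w ^ n) 0) * G (of_real a * w ^ n) (of_real b * w ^ Suc n))"
    if w: "norm w < 1" for w
  proof -
    let ?f = "\<lambda>t. G (of_real a * w ^ n) (of_real (r w) * t)"
    have rw: "r w > 0" "b / r w \<le> 1" using r_ge[OF w] b by auto
    have "norm w ^ Suc n < 1" using norm_power_Suc_less_one[OF w] by (simp only: norm_power)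
    then have "b / r w * norm w ^ Suc n < 1"
      using rw b by (metis divide_nonneg_pos less_eq_real_def mult_left_le_one_le norm_ge_zero order_le_less_trans zero_le_power)
    moreover have nrm: "norm (of_real (b / r w) * w ^ Suc n) = b / r w * norm w ^ Suc n"
      unfolding norm_mult norm_power norm_of_real using rw b by simp
    moreover have "?f holomorphic_on ball 0 1"
      unfolding G_def line3 using slice[OF w] by (intro holG) (simp flip: line3)
    moreover have "norm (?f t) < 1" if "norm t < 1" for t
      by (rule G_lt[OF slice[OF w that]])
    ultimately have "norm (?f (of_real (b / r w) * w ^ Suc n) - ?f 0) \<le> b / r w * norm w ^ Suc n *
        norm (1 - cnj (?f 0) * ?f (of_real (b / r w) * w ^ Suc n))"
      using Schwarz_Pick_at_0[of ?f "of_real (b / r w) * w ^ Suc n"] by metis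
    moreover have "of_real (r w) * (of_real (b / r w) * w ^ Suc n) = of_real b * w ^ Suc n"
      using rw by simp
    ultimately show ?thesis by simp
  qed
  define M where "M = (\<lambda>w. Moebius_function 0 \<beta> (?B w))"
  have M: "M w = G (of_real a * w ^ n) (of_real b * w ^ Suc n)" for w
    by (simp add: M_def G_def)
  \<comment> \<open>The axis value contributes \<open>norm w ^ n\<close>, and \<open>diff\<close>
    contributes twice that, since its last factor is at most \<open>2\<close>.\<close>
  have bigO: "norm (M w) \<le> 3 * norm w ^ n" if w: "norm w < 1" for w
  proof -
    let ?g = "G (of_real a * w ^ n) 0"
    have "c * norm (h (of_real c * w ^ n)) \<le> 1"
      using c h1[OF cw[OF w]] by (simp add: mult_le_one)
    then have g: "norm ?g \<le> norm w ^ n * 1"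
      unfolding axis_h[OF w] norm_mult norm_power using c by (intro mult_left_mono) auto
    moreover have "norm w ^ n \<le> 1" using w by (simp add: power_le_one)
    ultimately have "norm ?g \<le> 1" by simp
    moreover have "norm (M w) < 1"
      unfolding M by (rule G_lt[OF curve[OF w]])
    ultimately have "norm (1 - cnj ?g * M w) \<le> 1 + 1 * 1"
      by (intro order_trans[OF norm_triangle_ineq4] add_mono) (auto simp: norm_mult intro!: mult_le_one)
    moreover have "b / r w * norm w ^ Suc n \<le> 1 * norm w ^ n"
      using r_ge[OF w] b w by (intro mult_mono power_decreasing) auto
    ultimately have "norm (M w - ?g) \<le> (1 * norm w ^ n) * (1 + 1 * 1)"
      using order_trans[OF diff[OF w, folded M] mult_mono] by simp
    then show ?thesis
      using norm_triangle_sub[of "M w" ?g] g by simp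
  qed
  obtain N where holN: "N holomorphic_on unit_disc"
    and N: "\<And>w. w \<in> unit_disc \<Longrightarrow> M w = w ^ n * N w"
    and dN: "norm (deriv N 0) = 1 - (norm (N 0))\<^sup>2"
    using blaschke_product_Moebius_zero_order[OF B k n, of 3] F_lt[OF curve] bigO
    unfolding M_def \<beta>_def by (metis (no_types, lifting) mem_ball_0)
  \<comment> \<open>This is the right side of \<open>diff\<close> divided by
    \<open>norm w ^ Suc n\<close>. At \<open>0\<close> the product inside the norm vanishes and
    \<open>r 0 = 1 - a^2\<close>, so the limit is \<open>b / (1 - a^2)\<close>.\<close>
  define \<rho> where "\<rho> = (\<lambda>w. b / r w * norm (1 - cnj (w ^ n * (of_real c * h (of_real c * w ^ n))) * (w ^ n * N w)))"
  have "(norm (N 0))\<^sup>2 + norm (deriv N 0) \<le> c\<^sup>2 + b / (1 - a\<^sup>2)"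
  proof (rule Schwarz_Pick_difference_coefficients[OF holh h1 holN c n])
    have "isCont h 0" "isCont N 0"
      using holomorphic_on_imp_continuous_on[OF holh] holomorphic_on_imp_continuous_on[OF holN]
      by (simp_all add: continuous_on_eq_continuous_at)
    then have "isCont (\<lambda>w. h (of_real c * w ^ n)) 0"
      using n by (intro isCont_o2[where g = h and f = "\<lambda>w. of_real c * w ^ n"]) (simp_all add: zero_power)
    with \<open>isCont N 0\<close> have "(N \<longlongrightarrow> N 0) (at 0)" "((\<lambda>w. h (of_real c * w ^ n)) \<longlongrightarrow> h (of_real c * 0 ^ n)) (at 0)"
      by (simp_all add: isCont_def)
    moreover have "1 - (a + a * norm (0::complex) ^ n)\<^sup>2 \<noteq> 0"
      using r_ge[of 0] b by (simp add: r_def)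
    ultimately have "(\<rho> \<longlongrightarrow> \<rho> 0) (at 0)"
      unfolding \<rho>_def r_def by (intro tendsto_intros)
    then show "(\<rho> \<longlongrightarrow> b / (1 - a\<^sup>2)) (at 0)"
      using n by (simp add: \<rho>_def r_def zero_power)
    show "norm (N w - of_real c * h (of_real c * w ^ n)) \<le> norm w * \<rho> w" if "w \<in> unit_disc - {0}" for w
    proof -
      have w: "norm w < 1" "w \<in> unit_disc" "w \<noteq> 0" using that by auto
      have "norm w ^ n * norm (N w - of_real c * h (of_real c * w ^ n)) \<le> norm w ^ n * (norm w * \<rho> w)"
        using diff[OF w(1)] unfolding M[symmetric] axis_h[OF w(1)] N[OF w(2)]
          right_diff_distrib[symmetric] norm_mult[of "w ^ n" "_ - _"] norm_power
        by (simp only: \<rho>_def power_Suc mult_ac)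
      then show ?thesis using w(3) by simp
    qed
  qed
  \<comment> \<open>By \<open>dN\<close> the left side equals \<open>1\<close>. Clearing
    denominators and inserting \<open>b = 1 - 4 a^2\<close> leaves
    \<open>0 \<le> 2 a^2 (2 a - 1)\<close>, contrary to \<open>a < 1/2\<close>.\<close>
  then have "1 \<le> a\<^sup>2 / (1 - a)\<^sup>2 + b / (1 - a\<^sup>2)"
    unfolding dN by (simp add: c_def R_def power_divide)
  moreover have "1 - a > 0" "1 + a > 0" "1 - a\<^sup>2 = (1 - a) * (1 + a)"
    using a a2 by (auto simp: power2_eq_square algebra_simps)
  ultimately have "(1 - a)\<^sup>2 * (1 + a) \<le> (a\<^sup>2 / (1 - a)\<^sup>2 + b / ((1 - a) * (1 + a))) * ((1 - a)\<^sup>2 * (1 + a))"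
    by simp
  also have "\<dots> = a\<^sup>2 * (1 + a) + b * (1 - a)"
    using \<open>1 - a > 0\<close> \<open>1 + a > 0\<close> by (simp add: distrib_right power2_eq_square)
  also have "b = 1 - 4 * a\<^sup>2" using ab by simp
  finally have "0 \<le> 2 * a\<^sup>2 * (2 * a - 1)"
    by (simp add: power2_eq_square algebra_simps)
  then show False using a a2 by (simp add: zero_le_mult_iff)
qed

section \<open>Topology of the domain, the curve \<open>\<phi>\<close>, and the left inverse of
  \<open>f\<close>\<close>

lemma open_Dom: "open Dom"
  by (intro open_Collect_less continuous_intros)

lemma connected_Dom: "connected Dom"
proof (rule starlike_imp_connected)
  show "starlike Dom"
    unfolding starlike_def
  proof (intro bexI ballI subsetI)
    fix z y :: "complex ^ 3"
    assume z: "z \<in> Dom" and "y \<in> closed_segment 0 z"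
    then obtain u where u: "0 \<le> u" "u \<le> 1" "y = u *\<^sub>R z"
      by (auto simp: in_segment)
    have "u * (norm (z $ 1) + norm (z $ 2)) \<le> norm (z $ 1) + norm (z $ 2)" "u * norm (z $ 3) \<le> norm (z $ 3)"
      using u by (intro mult_left_le_one_le; simp)+
    then have "(u * (norm (z $ 1) + norm (z $ 2)))\<^sup>2 + u * norm (z $ 3)
        \<le> (norm (z $ 1) + norm (z $ 2))\<^sup>2 + norm (z $ 3)"
      using u by (intro add_mono power_mono) auto
    then show "y \<in> Dom" using z u by (simp add: distrib_left)
  qed simp
qed

text \<open>Away from \<open>u = 0\<close> the quotient agrees with a continuous monomial, so a
  single limit argument covers both \<open>w = 0\<close> and \<open>w \<noteq> 0\<close>.\<close>

lemma remove_sings_monomial_quotient: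
  "remove_sings (\<lambda>u. c * u ^ Suc j / u) w = c * w ^ j"
proof (rule remove_sings_eqI)
  have "\<forall>\<^sub>F u in at w. u \<noteq> 0" by (rule eventually_neq_at_within)
  then have "\<forall>\<^sub>F u in at w. c * u ^ j = c * u ^ Suc j / u"
    by eventually_elim simp
  moreover have "((\<lambda>u. c * u ^ j) \<longlongrightarrow> c * w ^ j) (at w)"
    by (intro tendsto_intros)
  ultimately show "((\<lambda>u. c * u ^ Suc j / u) \<longlongrightarrow> c * w ^ j) (at w)"
    by (rule Lim_transform_eventually[rotated])
qed

lemma blaschke_product_power: "blaschke_product k (\<lambda>w. w ^ k)"
  unfolding blaschke_product_def
  by (rule exI[of _ 1], rule exI[of _ "\<lambda>_. 0"]) (simp add: Moebius_function_simple)

lemma holomorphic_fun_on_4_z1_z2_plus_z3: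
  "holomorphic_fun_on (\<lambda>z. 4 * z $ 1 * z $ 2 + z $ 3) (D :: (complex ^ 3) set)"
  unfolding holomorphic_fun_on_def
proof (intro ballI exI conjI)
  fix z :: "complex ^ 3"
  note [derivative_intros] = bounded_linear.has_derivative[OF bounded_linear_vec_nth]
  show "((\<lambda>z. 4 * z $ 1 * z $ 2 + z $ 3) has_derivative
      (\<lambda>v. 4 * z $ 1 * v $ 2 + 4 * v $ 1 * z $ 2 + v $ 3)) (at z)"
    by (auto intro!: derivative_eq_intros)
qed (simp add: algebra_simps)

text \<open>By the inequality of arithmetic and geometric means, \<open>4 |z_1| |z_2|\<close> is at
  most \<open>(|z_1| + |z_2|)^2\<close>.\<close>

lemma norm_4_z1_z2_plus_z3_less_1:
  fixes z :: "complex ^ 3"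
  assumes "z \<in> Dom"
  shows "norm (4 * z $ 1 * z $ 2 + z $ 3) < 1"
proof -
  have "4 * norm (z $ 1) * norm (z $ 2) \<le> (norm (z $ 1) + norm (z $ 2))\<^sup>2"
    using zero_le_power2[of "norm (z $ 1) - norm (z $ 2)"] by (simp add: power2_eq_square algebra_simps)
  then show ?thesis
    using norm_triangle_ineq[of "4 * z $ 1 * z $ 2" "z $ 3"] assms by (simp add: norm_mult)
qed

theorem proposition4p4:
  fixes m :: nat and a b :: real
    and D :: "(complex ^ 3) set" and f \<phi> :: "complex \<Rightarrow> complex ^ 3"
  assumes "m \<ge> 4" and "a > 0" and "b > 0" and "4 * a^2 + b = 1"
    and "D = {z. (norm (z $ 1) + norm (z $ 2))^2 + norm (z $ 3) < 1}"
    and "f = (\<lambda>w. vector [of_real a * w, of_real a * w ^ (m - 2), of_real b * w ^ (m - 1)])"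
    and "\<phi> = divide_by_id f"
  shows "geodesic_in m D f \<and> holomorphic_disc_in \<phi> D \<and> \<not> geodesic_in (m - 1) D \<phi>"
proof -
  note D = assms(5)
  \<comment> \<open>With \<open>n = m - 3\<close>, the hypothesis \<open>m \<ge> 4\<close> makes
    \<open>n\<close> positive, so the second coordinate of \<open>\<phi>\<close> vanishes at
    \<open>0\<close>.\<close>
  have "m = Suc (Suc (Suc (m - 3)))" "m - 3 > 0" using assms(1) by auto
  then obtain n where m: "m = Suc (Suc (Suc n))" and n: "n > 0" by blast
  have f: "f = (\<lambda>w. vector [of_real a * w, of_real a * w ^ Suc n, of_real b * w ^ Suc (Suc n)])"
    unfolding assms(6) m by simp
  have \<phi>: "\<phi> w = vector [of_real a, of_real a * w ^ n, of_real b * w ^ Suc n]" for w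
    using remove_sings_monomial_quotient[of "of_real a" 0 w]
      remove_sings_monomial_quotient[of "of_real a" n w]
      remove_sings_monomial_quotient[of "of_real b" "Suc n" w]
    unfolding assms(7) divide_by_id_def f vec_eq_iff forall_3 by simp
  have in_D: "vector [of_real a * x, of_real a * y, of_real b * z] \<in> D"
    if "norm x \<le> 1" "norm y \<le> 1" "norm z < 1" for x y z
    unfolding D using scaled_polydisc_in_Dom[OF assms(2-4) that] .
  have "holomorphic_disc_in f D"
    unfolding holomorphic_disc_in_def
  proof (intro conjI)
    show "\<forall>i. (\<lambda>w. f w $ i) holomorphic_on unit_disc"
      unfolding forall_3 f by (auto intro!: holomorphic_intros)
    show "f ` unit_disc \<subseteq> D"
      unfolding f using norm_power_Suc_less_one by (fastforce intro!: in_D intro: less_imp_le simp del: power_Suc)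
  qed
  moreover have "holomorphic_disc_in \<phi> D"
    unfolding holomorphic_disc_in_def
  proof (intro conjI)
    show "\<forall>i. (\<lambda>w. \<phi> w $ i) holomorphic_on unit_disc"
      unfolding forall_3 \<phi> by (auto intro!: holomorphic_intros)
    have "\<phi> w \<in> D" if "norm w < 1" for w
      using in_D[of 1 "w ^ n" "w ^ Suc n"] norm_power_Suc_less_one[OF that, of n] that
      by (simp add: \<phi> norm_power power_le_one)
    then show "\<phi> ` unit_disc \<subseteq> D" by auto
  qed
  moreover have "geodesic_in m D f"
    unfolding geodesic_in_def
  proof (intro conjI exI)
    let ?F = "\<lambda>z :: complex ^ 3. 4 * z $ 1 * z $ 2 + z $ 3"
    have Ff: "?F \<circ> f = (\<lambda>w. w ^ (m - 1))"
    proof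
      fix w
      have "(?F \<circ> f) w = of_real (4 * a^2 + b) * w ^ (m - 1)"
        by (simp add: f m power2_eq_square algebra_simps)
      then show "(?F \<circ> f) w = w ^ (m - 1)" using assms(4) by simp
    qed
    show "2 \<le> m" "open D" "connected D"
      using m open_Dom connected_Dom unfolding D by auto
    show "holomorphic_disc_in f D" by fact
    show "holomorphic_fun_on ?F D" by (rule holomorphic_fun_on_4_z1_z2_plus_z3)
    show "?F ` D \<subseteq> unit_disc"
      unfolding D using norm_4_z1_z2_plus_z3_less_1 by auto
    show "m - 1 \<le> m - 1" ..
    show "blaschke_product (m - 1) (?F \<circ> f)"
      unfolding Ff by (rule blaschke_product_power)
    show "\<not> (?F \<circ> f) constant_on unit_disc"
    proof
      assume "(?F \<circ> f) constant_on unit_disc"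
      then have "(0 :: complex) ^ (m - 1) = (1 / 2) ^ (m - 1)"
        unfolding Ff constant_on_def by force
      then show False by (simp add: m)
    qed
  qed
  moreover have "\<not> geodesic_in (m - 1) D \<phi>"
  proof
    \<comment> \<open>An \<open>(m - 1)\<close>-geodesic allows degree at most \<open>m - 2\<close>,
      that is \<open>n + 1\<close>.\<close>
    assume "geodesic_in (m - 1) D \<phi>"
    then obtain F k where F: "holomorphic_fun_on F D" "F ` D \<subseteq> unit_disc"
      and k: "k \<le> Suc n" and "blaschke_product k (F \<circ> \<phi>)"
      unfolding geodesic_in_def m by auto
    then show False
      using no_left_inverse_of_reduced_curve[OF assms(2-4) n F[unfolded D] k] by (simp add: o_def \<phi>)
  qed
  ultimately show ?thesis by blast
qed

end
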